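(* Let $Q$ be a half-finite bipartite recurrent quiver. Assume that $\Gamma(Q)$ consists of connected components which are all $ADE$ Dynkin diagrams. Further assume that, with the orientation induced by $Q$, the white vertices are sinks in $\Gamma(Q)$ and sources in $\Delta(Q)$. Let $h$ be the Coxeter number of some component of $\Gamma(Q)$. If $h=2k$ is even, then $(\mu_{\bullet}\mu_{\circ})^k$ is a maximal green sequence of $Q$. If $h=2k+1$ is odd, then $\mu_{\circ}(\mu_{\bullet}\mu_{\circ})^k$ is a maximal green sequence of $Q$.
   Context: A quiver $Q$ is a directed multigraph with vertex set $V(Q)$ and edge set $E(Q)$ (edges are called arrows) without loops or 2-cycles. An ice quiver is a quiver with a designated set $F\subseteq V(Q)$ of frozen vertices with no arrows between elements of $F$; the other vertices are mutable. The framed quiver $\widehat{Q}$ has vertex set $V(Q)\sqcup\{v' : v\in V(Q)\}$, arrows $E(Q)\sqcup\{v\to v' : v\in V(Q)\}$, and frozen vertices $\{v' : v\in V(Q)\}$. Mutation $\mu_i$ at a mutable vertex $i$: (1) for each pair of arrows $j\to i$, $i\to k$ with $j,k$ not both frozen, add an arrow $j\to k$; (2) reverse all arrows incident to $i$; (3) delete a maximal collection of disjoint 2-cycles. The frozen set is unchanged. In an ice quiver obtained from a framed quiver by mutations, a mutable vertex is green if there are no arrows to it from frozen vertices, and red if there are no arrows from it to frozen vertices; by sign-coherence (known) every mutable vertex is either green or red. A sequence of mutations at mutable vertices starting from $\widehat Q$ is a maximal green sequence of $Q$ if each mutation is performed at a vertex that is green at that moment and all mutable vertices are red at the end. Sequences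 written as compositions are performed from right to left. A quiver $Q$ is bipartite if there is a map (bipartition) $\epsilon:V(Q)\to\{0,1\}$ with $\epsilon(i)\ne\epsilon(j)$ for every arrow $i\to j$; a choice of $\epsilon$ is fixed. Vertex $i$ is white if $\epsilon(i)=0$ and black if $\epsilon(i)=1$. With $i_1,\dots,i_\ell$ the white vertices and $j_1,\dots,j_m$ the black vertices, $\mu_\circ=\mu_{i_1}\circ\cdots\circ\mu_{i_\ell}$ and $\mu_\bullet=\mu_{j_1}\circ\cdots\circ\mu_{j_m}$ (the order within each does not matter). A bipartite quiver is recurrent if $\mu_\circ(Q)=Q^{op}$ and $\mu_\bullet(Q)=Q^{op}$, where $Q^{op}$ is $Q$ with all arrows reversed. The bigraph of $Q$ is the pair $(\Gamma(Q),\Delta(Q))$ of undirected graphs on vertex set $V(Q)$ in which $\Gamma(Q)$ has an edge $\{i,j\}$ for each arrow $i\to j$ with $i$ black and $j$ white, and $\Delta(Q)$ has an edge $\{i,j\}$ for each arrow $i\to j$ with $i$ white and $j$ black. Both are also regarded as directed graphs with the edge directions inherited from $Q$. Half-finite means that for at least one of $\Gamma(Q)$, $\Delta(Q)$ every connected component is an $ADE$ Dynkin diagram. Coxeter numbers: $A_n$: $n+1$; $D_n$: $2n-2$; $E_6$: $12$; $E_7$: $18$; $E_8$: $30$.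
   Formalization: The quiver Q is additionally assumed connected; for disconnected Q the components of Γ(Q) may have different Coxeter numbers and the claim fails, e.g. for one arrow b→w together with an isolated white vertex. *)

theory Defs
  imports Main
begin

text \<open>
  Ice quivers are finite directed multigraphs up to relabelling of parallel arrows:
  \<open>arrows Q i j\<close> is the number of arrows \<open>i \<rightarrow> j\<close>, and it vanishes unless both ends are vertices,
  so that equality of records is equality of quivers on labelled vertices.
  A quiver is an ice quiver without frozen vertices.
\<close>

record 'v ice_quiver =
  verts :: "'v set"
  frozen :: "'v set"
  arrows :: "'v \<Rightarrow> 'v \<Rightarrow> nat"

definition is_ice_quiver :: "'v ice_quiver \<Rightarrow> bool" where
  "is_ice_quiver Q \<longleftrightarrow>
     finite (verts Q) \<and> frozen Q \<subseteq> verts Q \<and>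
     (\<forall>i j. arrows Q i j \<noteq> 0 \<longrightarrow> i \<in> verts Q \<and> j \<in> verts Q) \<and>
     (\<forall>i. arrows Q i i = 0) \<and>
     (\<forall>i j. arrows Q i j = 0 \<or> arrows Q j i = 0) \<and>
     (\<forall>i\<in>frozen Q. \<forall>j\<in>frozen Q. arrows Q i j = 0)"

definition is_quiver :: "'v ice_quiver \<Rightarrow> bool" where
  "is_quiver Q \<longleftrightarrow> is_ice_quiver Q \<and> frozen Q = {}"

definition mutable :: "'v ice_quiver \<Rightarrow> 'v set" where
  "mutable Q = verts Q - frozen Q"

definition op_quiver :: "'v ice_quiver \<Rightarrow> 'v ice_quiver" where
  "op_quiver Q = Q\<lparr>arrows := \<lambda>i j. arrows Q j i\<rparr>"

text \<open>The vertex \<open>v\<close> of \<open>Q\<close> becomes \<open>Inl v\<close> in the framed quiver, and its frozen copy \<open>v'\<close> is \<open>Inr v\<close>.\<close>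

fun framed_arrows :: "'v ice_quiver \<Rightarrow> 'v + 'v \<Rightarrow> 'v + 'v \<Rightarrow> nat" where
  "framed_arrows Q (Inl i) (Inl j) = arrows Q i j"
| "framed_arrows Q (Inl i) (Inr j) = (if i \<in> verts Q \<and> i = j then 1 else 0)"
| "framed_arrows Q (Inr i) _ = 0"

definition framed :: "'v ice_quiver \<Rightarrow> ('v + 'v) ice_quiver" where
  "framed Q = \<lparr>verts = verts Q <+> verts Q, frozen = Inr ` verts Q, arrows = framed_arrows Q\<rparr>"

text \<open>The three steps of mutation at \<open>i\<close>.\<close>

definition add_paths :: "'v \<Rightarrow> 'v ice_quiver \<Rightarrow> 'v ice_quiver" where
  "add_paths i Q = Q\<lparr>arrows := \<lambda>j k. arrows Q j k +
     (if j \<in> frozen Q \<and> k \<in> frozen Q then 0 else arrows Q j i * arrows Q i k)\<rparr>"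

definition reverse_at :: "'v \<Rightarrow> 'v ice_quiver \<Rightarrow> 'v ice_quiver" where
  "reverse_at i Q = Q\<lparr>arrows := \<lambda>j k. if j = i \<or> k = i then arrows Q k j else arrows Q j k\<rparr>"

text \<open>
  A maximal collection of disjoint 2-cycles between \<open>j\<close> and \<open>k\<close> uses
  \<open>min (arrows Q j k) (arrows Q k j)\<close> arrows in each direction; removing them leaves the
  truncated difference of the two multiplicities.
\<close>

definition cancel_2cycles :: "'v ice_quiver \<Rightarrow> 'v ice_quiver" where
  "cancel_2cycles Q = Q\<lparr>arrows := \<lambda>j k. arrows Q j k - arrows Q k j\<rparr>"

definition mutate :: "'v \<Rightarrow> 'v ice_quiver \<Rightarrow> 'v ice_quiver" where
  "mutate i Q = cancel_2cycles (reverse_at i (add_paths i Q))"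

text \<open>
  A composition of mutations \<open>\<mu>\<^sub>v\<^sub>1 \<circ> \<dots> \<circ> \<mu>\<^sub>v\<^sub>r\<close> is the word \<open>[v\<^sub>1, \<dots>, v\<^sub>r]\<close>; as for
  functions, the last letter is performed first.
\<close>

definition mutate_word :: "'v list \<Rightarrow> 'v ice_quiver \<Rightarrow> 'v ice_quiver" where
  "mutate_word w Q = foldr mutate w Q"

definition green :: "'v ice_quiver \<Rightarrow> 'v \<Rightarrow> bool" where
  "green Q v \<longleftrightarrow> v \<in> mutable Q \<and> (\<forall>f\<in>frozen Q. arrows Q f v = 0)"

definition red :: "'v ice_quiver \<Rightarrow> 'v \<Rightarrow> bool" where
  "red Q v \<longleftrightarrow> v \<in> mutable Q \<and> (\<forall>f\<in>frozen Q. arrows Q v f = 0)"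

text \<open>In \<open>w = us @ v # vs\<close> the letters \<open>vs\<close> are the mutations performed before the one at \<open>v\<close>.\<close>

definition maximal_green_sequence :: "'v ice_quiver \<Rightarrow> 'v list \<Rightarrow> bool" where
  "maximal_green_sequence Q w \<longleftrightarrow>
     (\<forall>us v vs. w = us @ v # vs \<longrightarrow> green (mutate_word (map Inl vs) (framed Q)) (Inl v)) \<and>
     (\<forall>x \<in> mutable (mutate_word (map Inl w) (framed Q)).
        red (mutate_word (map Inl w) (framed Q)) x)"

definition bipartition :: "'v ice_quiver \<Rightarrow> ('v \<Rightarrow> nat) \<Rightarrow> bool" where
  "bipartition Q \<epsilon> \<longleftrightarrow>
     (\<forall>v\<in>verts Q. \<epsilon> v \<in> {0, 1}) \<and> (\<forall>i j. arrows Q i j \<noteq> 0 \<longrightarrow> \<epsilon> i \<noteq> \<epsilon> j)"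

definition white :: "'v ice_quiver \<Rightarrow> ('v \<Rightarrow> nat) \<Rightarrow> 'v set" where
  "white Q \<epsilon> = {v \<in> verts Q. \<epsilon> v = 0}"

definition black :: "'v ice_quiver \<Rightarrow> ('v \<Rightarrow> nat) \<Rightarrow> 'v set" where
  "black Q \<epsilon> = {v \<in> verts Q. \<epsilon> v = 1}"

definition enumerates :: "'a list \<Rightarrow> 'a set \<Rightarrow> bool" where
  "enumerates xs S \<longleftrightarrow> distinct xs \<and> set xs = S"

text \<open>
  Here \<open>ws\<close> and \<open>bs\<close> are enumerations of the white and of the black vertices, that is, the words
  of \<open>\<mu>\<^sub>\<circ>\<close> and \<open>\<mu>\<^sub>\<bullet>\<close>.
\<close>

definition recurrent :: "'v ice_quiver \<Rightarrow> 'v list \<Rightarrow> 'v list \<Rightarrow> bool" where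
  "recurrent Q ws bs \<longleftrightarrow> mutate_word ws Q = op_quiver Q \<and> mutate_word bs Q = op_quiver Q"

text \<open>
  The two graphs of the bigraph, with edge multiplicities: first with the directions inherited
  from \<open>Q\<close>, then undirected.
\<close>

definition Gamma_dir :: "'v ice_quiver \<Rightarrow> ('v \<Rightarrow> nat) \<Rightarrow> 'v \<Rightarrow> 'v \<Rightarrow> nat" where
  "Gamma_dir Q \<epsilon> i j = (if i \<in> black Q \<epsilon> \<and> j \<in> white Q \<epsilon> then arrows Q i j else 0)"

definition Delta_dir :: "'v ice_quiver \<Rightarrow> ('v \<Rightarrow> nat) \<Rightarrow> 'v \<Rightarrow> 'v \<Rightarrow> nat" where
  "Delta_dir Q \<epsilon> i j = (if i \<in> white Q \<epsilon> \<and> j \<in> black Q \<epsilon> then arrows Q i j else 0)"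

definition undirected :: "('v \<Rightarrow> 'v \<Rightarrow> nat) \<Rightarrow> 'v \<Rightarrow> 'v \<Rightarrow> nat" where
  "undirected d i j = d i j + d j i"

definition Gamma :: "'v ice_quiver \<Rightarrow> ('v \<Rightarrow> nat) \<Rightarrow> 'v \<Rightarrow> 'v \<Rightarrow> nat" where
  "Gamma Q \<epsilon> = undirected (Gamma_dir Q \<epsilon>)"

definition Delta :: "'v ice_quiver \<Rightarrow> ('v \<Rightarrow> nat) \<Rightarrow> 'v \<Rightarrow> 'v \<Rightarrow> nat" where
  "Delta Q \<epsilon> = undirected (Delta_dir Q \<epsilon>)"

definition is_sink :: "'v set \<Rightarrow> ('v \<Rightarrow> 'v \<Rightarrow> nat) \<Rightarrow> 'v \<Rightarrow> bool" where
  "is_sink V d v \<longleftrightarrow> (\<forall>u\<in>V. d v u = 0)"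

definition is_source :: "'v set \<Rightarrow> ('v \<Rightarrow> 'v \<Rightarrow> nat) \<Rightarrow> 'v \<Rightarrow> bool" where
  "is_source V d v \<longleftrightarrow> (\<forall>u\<in>V. d u v = 0)"

text \<open>An undirected multigraph is a vertex set \<open>V\<close> with a symmetric multiplicity function \<open>m\<close>.\<close>

definition reachability :: "'v set \<Rightarrow> ('v \<Rightarrow> 'v \<Rightarrow> nat) \<Rightarrow> ('v \<times> 'v) set" where
  "reachability V m =
     {(u, v). u \<in> V \<and> v \<in> V \<and> (u, v) \<in> {(x, y). x \<in> V \<and> y \<in> V \<and> m x y \<noteq> 0}\<^sup>*}"

definition components :: "'v set \<Rightarrow> ('v \<Rightarrow> 'v \<Rightarrow> nat) \<Rightarrow> 'v set set" where
  "components V m = V // reachability V m"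

definition connected_quiver :: "'v ice_quiver \<Rightarrow> bool" where
  "connected_quiver Q \<longleftrightarrow> reachability (verts Q) (undirected (arrows Q)) = verts Q \<times> verts Q"

datatype dynkin = Type_A nat | Type_D nat | Type_E6 | Type_E7 | Type_E8

text \<open>Starting type \<open>D\<close> at rank 4 makes the type of a diagram unique.\<close>

fun valid_dynkin :: "dynkin \<Rightarrow> bool" where
  "valid_dynkin (Type_A n) \<longleftrightarrow> n \<ge> 1"
| "valid_dynkin (Type_D n) \<longleftrightarrow> n \<ge> 4"
| "valid_dynkin _ \<longleftrightarrow> True"

fun rank :: "dynkin \<Rightarrow> nat" where
  "rank (Type_A n) = n"
| "rank (Type_D n) = n"
| "rank Type_E6 = 6"
| "rank Type_E7 = 7"
| "rank Type_E8 = 8"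

fun coxeter_number :: "dynkin \<Rightarrow> nat" where
  "coxeter_number (Type_A n) = n + 1"
| "coxeter_number (Type_D n) = 2 * n - 2"
| "coxeter_number Type_E6 = 12"
| "coxeter_number Type_E7 = 18"
| "coxeter_number Type_E8 = 30"

text \<open>
  The vertices of a diagram of rank \<open>n\<close> are \<open>0, \<dots>, n - 1\<close>. Type \<open>A\<close> is the path
  through all of them; in types \<open>D\<close> and \<open>E\<close> the vertices \<open>0, \<dots>, n - 2\<close> form a path and
  \<open>n - 1\<close> is attached to \<open>n - 3\<close> and to \<open>2\<close>, respectively.
\<close>

definition path_edges :: "nat \<Rightarrow> nat set set" where
  "path_edges n = {{i, i + 1} | i. i + 1 < n}"

fun dynkin_edges :: "dynkin \<Rightarrow> nat set set" where
  "dynkin_edges (Type_A n) = path_edges n"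
| "dynkin_edges (Type_D n) = path_edges (n - 1) \<union> {{n - 3, n - 1}}"
| "dynkin_edges Type_E6 = path_edges 5 \<union> {{2, 5}}"
| "dynkin_edges Type_E7 = path_edges 6 \<union> {{2, 6}}"
| "dynkin_edges Type_E8 = path_edges 7 \<union> {{2, 7}}"

text \<open>The subgraph of \<open>m\<close> induced on \<open>C\<close> is isomorphic to the diagram \<open>X\<close>; all edges are simple.\<close>

definition has_dynkin_type :: "('v \<Rightarrow> 'v \<Rightarrow> nat) \<Rightarrow> 'v set \<Rightarrow> dynkin \<Rightarrow> bool" where
  "has_dynkin_type m C X \<longleftrightarrow> valid_dynkin X \<and>
     (\<exists>\<phi>. bij_betw \<phi> {..<rank X} C \<and>
        (\<forall>i<rank X. \<forall>j<rank X. m (\<phi> i) (\<phi> j) = (if {i, j} \<in> dynkin_edges X then 1 else 0)))"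

definition all_components_ADE :: "'v set \<Rightarrow> ('v \<Rightarrow> 'v \<Rightarrow> nat) \<Rightarrow> bool" where
  "all_components_ADE V m \<longleftrightarrow> (\<forall>C\<in>components V m. \<exists>X. has_dynkin_type m C X)"

definition half_finite :: "'v ice_quiver \<Rightarrow> ('v \<Rightarrow> nat) \<Rightarrow> bool" where
  "half_finite Q \<epsilon> \<longleftrightarrow>
     all_components_ADE (verts Q) (Gamma Q \<epsilon>) \<or> all_components_ADE (verts Q) (Delta Q \<epsilon>)"

definition word_power :: "'a list \<Rightarrow> nat \<Rightarrow> 'a list" where
  "word_power w k = concat (replicate k w)"

end

theory Submission
  imports Defs
begin

text \<open>
  Recurrence says that the adjacency matrices \<open>\<Gamma>\<close> and \<open>\<Delta>\<close> commute, and that the mutable part is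
  \<open>Q\<close> or its opposite after each half-step. As long as everything mutated is green, only \<open>\<Gamma>\<close>
  acts on the c-vectors, by the two-term recurrence of the Chebyshev polynomials \<open>U\<^sub>t\<close>, so after
  \<open>t\<close> half-steps they are sums of entries of \<open>U\<^sub>t(\<Gamma>)\<close> and \<open>U\<^sub>t\<^sub>-\<^sub>1(\<Gamma>)\<close> up to sign. For an \<open>ADE\<close> diagram
  with Coxeter number \<open>h\<close> these matrices are nonnegative for \<open>t < h\<close>, and \<open>U\<^sub>h\<^sub>-\<^sub>1\<close> vanishes, which
  makes \<open>U\<^sub>h = - U\<^sub>h\<^sub>-\<^sub>2\<close>: all vertices are red after \<open>h\<close> half-steps. All components of \<open>\<Gamma>\<close>
  have the same \<open>h\<close> because \<open>U\<^sub>h\<^sub>-\<^sub>1(\<Gamma>)\<close> commutes with \<open>\<Delta>\<close> and \<open>Q\<close> is connected.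
\<close>

section \<open>Mutation at pairwise non-adjacent vertices\<close>

text \<open>The signed exchange matrix. Cancelling 2-cycles does not change it, so mutation acts on
  it without truncated subtraction.\<close>

definition exch :: "'v ice_quiver \<Rightarrow> 'v \<Rightarrow> 'v \<Rightarrow> int" where
  "exch Q i j = int (arrows Q i j) - int (arrows Q j i)"

text \<open>The net amount that step (1) of mutation at \<open>u\<close> adds to
  \<open>exch Q j k\<close>, unless both ends are frozen.\<close>

definition through_paths :: "'v ice_quiver \<Rightarrow> 'v \<Rightarrow> 'v \<Rightarrow> 'v \<Rightarrow> int" where
  "through_paths Q u j k =
     int (arrows Q j u) * int (arrows Q u k) - int (arrows Q k u) * int (arrows Q u j)"

lemma exch_antisym: "exch Q j i = - exch Q i j"
  by (simp add: exch_def)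

text \<open>One of the two opposite multiplicities is zero, so an ice quiver can be recovered from
  its signed matrix.\<close>

lemma arrows_eq_exch:
  assumes "is_ice_quiver Q"
  shows "arrows Q i j = nat (exch Q i j)"
proof -
  have "arrows Q i j = 0 \<or> arrows Q j i = 0"
    using assms by (simp add: is_ice_quiver_def)
  then show ?thesis by (auto simp: exch_def)
qed

lemma mutate_verts [simp]: "verts (mutate i Q) = verts Q" "frozen (mutate i Q) = frozen Q"
  by (simp_all add: mutate_def cancel_2cycles_def reverse_at_def add_paths_def)

text \<open>Without a loop at \<open>i\<close>, adding paths leaves the arrows incident to
  \<open>i\<close> alone, so the reversal sees the original multiplicities.\<close>

lemma arrows_mutate:
  assumes "is_ice_quiver Q"
  shows "arrows (mutate i Q) j k =
    (let a = (\<lambda>j k. if j = i \<or> k = i then arrows Q k j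
       else arrows Q j k + (if j \<in> frozen Q \<and> k \<in> frozen Q then 0 else arrows Q j i * arrows Q i k))
     in a j k - a k j)"
proof -
  have "arrows Q i i = 0" using assms by (simp add: is_ice_quiver_def)
  then show ?thesis
    by (auto simp: mutate_def cancel_2cycles_def reverse_at_def add_paths_def Let_def)
qed

lemma exch_mutate:
  assumes "is_ice_quiver Q"
  shows "exch (mutate i Q) j k =
    (if j = i \<or> k = i then - exch Q j k
     else exch Q j k + (if j \<in> frozen Q \<and> k \<in> frozen Q then 0 else through_paths Q i j k))"
proof -
  have trunc: "int (x - y) - int (y - x) = int x - int y" for x y :: nat by simp
  show ?thesis
    unfolding exch_def arrows_mutate[OF assms] Let_def trunc
    by (auto simp: through_paths_def)
qed

lemma is_ice_quiver_mutate:
  assumes Q: "is_ice_quiver Q" and i: "i \<in> mutable Q"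
  shows "is_ice_quiver (mutate i Q)"
proof -
  have supp: "i \<in> verts Q \<and> j \<in> verts Q" if "arrows Q i j \<noteq> 0" for i j
    using Q that by (simp add: is_ice_quiver_def)
  have "j \<in> verts Q \<and> k \<in> verts Q" if "arrows (mutate i Q) j k \<noteq> 0" for j k
  proof -
    have "arrows Q k j \<noteq> 0 \<or> arrows Q j k \<noteq> 0 \<or> arrows Q j i \<noteq> 0 \<and> arrows Q i k \<noteq> 0"
    proof (rule ccontr)
      assume "\<not> ?thesis"
      then have "arrows Q k j = 0" "arrows Q j k = 0" "arrows Q j i * arrows Q i k = 0" by auto
      then show False using that by (auto simp: arrows_mutate[OF Q] Let_def split: if_splits)
    qed
    then show ?thesis using supp by blast
  qed
  moreover have "arrows (mutate i Q) j k = 0 \<or> arrows (mutate i Q) k j = 0" for j k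
    unfolding arrows_mutate[OF Q] Let_def by linarith
  ultimately show ?thesis
    using assms by (auto simp: is_ice_quiver_def arrows_mutate[OF Q] Let_def mutable_def)
qed

lemma mutate_word_simps [simp]:
  "mutate_word [] Q = Q"
  "mutate_word (u # w) Q = mutate u (mutate_word w Q)"
  "mutate_word (w @ w') Q = mutate_word w (mutate_word w' Q)"
  by (simp_all add: mutate_word_def)

text \<open>Mutation at one letter does not alter the arrows at the other, non-adjacent letters.
  Hence all path contributions can be read off in \<open>Q\<close> and added, whatever the order of
  the word.\<close>

lemma mutate_word_independent:
  assumes Q: "is_ice_quiver Q" and "distinct w" and "set w \<subseteq> mutable Q"
    and "\<And>u v. u \<in> set w \<Longrightarrow> v \<in> set w \<Longrightarrow> arrows Q u v = 0"
  shows "is_ice_quiver (mutate_word w Q) \<and> verts (mutate_word w Q) = verts Q \<and>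
    frozen (mutate_word w Q) = frozen Q \<and>
    (\<forall>j k. exch (mutate_word w Q) j k =
      (if j \<in> set w \<or> k \<in> set w then - exch Q j k
       else exch Q j k +
         (if j \<in> frozen Q \<and> k \<in> frozen Q then 0 else \<Sum>u\<in>set w. through_paths Q u j k)))"
  using assms(2-)
proof (induction w)
  case Nil
  then show ?case using Q by simp
next
  case (Cons u w)
  define S where "S = mutate_word w Q"
  have indep: "arrows Q x y = 0" if "x \<in> insert u (set w)" "y \<in> insert u (set w)" for x y
    using Cons.prems(3) that by simp
  have u: "u \<notin> set w" using Cons.prems by simp
  have S: "is_ice_quiver S" "verts S = verts Q" "frozen S = frozen Q"
    and exS: "exch S j k = (if j \<in> set w \<or> k \<in> set w then - exch Q j k
       else exch Q j k + (if j \<in> frozen Q \<and> k \<in> frozen Q then 0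
         else \<Sum>u\<in>set w. through_paths Q u j k))" for j k
    using Cons unfolding S_def by auto
  \<comment> \<open>The entry is zero if \<open>j\<close> is a letter, so its sign does not matter;
    otherwise a new path ending at \<open>u\<close> would need an arrow between two letters.\<close>
  have exu: "exch S j u = exch Q j u" for j
  proof (cases "j \<in> set w")
    case True
    then show ?thesis using exS[of j u] indep[of j u] indep[of u j] by (simp add: exch_def)
  next
    case False
    have "(\<Sum>x\<in>set w. through_paths Q x j u) = 0"
      by (rule sum.neutral) (simp add: through_paths_def indep)
    then show ?thesis using exS[of j u] False u by simp
  qed
  have aru: "arrows S j u = arrows Q j u" "arrows S u j = arrows Q u j" for j
    using exu[of j] exch_antisym[of S u j] exch_antisym[of Q u j]
      arrows_eq_exch[OF S(1)] arrows_eq_exch[OF Q] by metis+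
  have tp: "through_paths S u j k = through_paths Q u j k" for j k
    by (simp add: through_paths_def aru)
  \<comment> \<open>Hence the mutation at \<open>u\<close> does not disturb the signs already
    flipped at the letters of \<open>w\<close>.\<close>
  have tp0: "through_paths Q u j k = 0" if "j \<in> set w \<or> k \<in> set w" for j k
    using that indep by (auto simp: through_paths_def)
  have um: "u \<in> mutable S" using Cons.prems S by (simp add: mutable_def)
  have exu': "exch S u j = exch Q u j" for j
    using exu[of j] exch_antisym[of S u j] exch_antisym[of Q u j] by simp
  have "exch (mutate u S) j k =
      (if j \<in> set (u # w) \<or> k \<in> set (u # w) then - exch Q j k
       else exch Q j k +
         (if j \<in> frozen Q \<and> k \<in> frozen Q then 0 else \<Sum>x\<in>set (u # w). through_paths Q x j k))"
    for j k
  proof (cases "j = u \<or> k = u")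
    case True
    then show ?thesis using exu[of j] exu'[of k] by (auto simp: exch_mutate[OF S(1)])
  next
    case False
    then show ?thesis using u tp0[of j k]
      by (auto simp: exch_mutate[OF S(1)] exS S tp)
  qed
  then show ?case
    using S is_ice_quiver_mutate[OF S(1) um] by (simp add: S_def[symmetric])
qed

text \<open>The greenness condition of a green sequence in recursive form and for any starting
  quiver, so that it splits over concatenated words.\<close>

fun green_word :: "'v ice_quiver \<Rightarrow> 'v list \<Rightarrow> bool" where
  "green_word Q [] \<longleftrightarrow> True"
| "green_word Q (v # w) \<longleftrightarrow> green (mutate_word w Q) v \<and> green_word Q w"

lemma green_word_append:
  "green_word Q (w @ w') \<longleftrightarrow> green_word (mutate_word w' Q) w \<and> green_word Q w'"
  by (induction w) auto

lemma green_word_independent: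
  assumes Q: "is_ice_quiver Q" and "distinct w" and "set w \<subseteq> mutable Q"
    and "\<And>u v. u \<in> set w \<Longrightarrow> v \<in> set w \<Longrightarrow> arrows Q u v = 0"
    and "\<And>u f. u \<in> set w \<Longrightarrow> f \<in> frozen Q \<Longrightarrow> 0 \<le> exch Q u f"
  shows "green_word Q w"
  using assms(2-)
proof (induction w)
  case Nil
  then show ?case by simp
next
  case (Cons u w)
  define S where "S = mutate_word w Q"
  have "is_ice_quiver S \<and> verts S = verts Q \<and> frozen S = frozen Q \<and>
    (\<forall>j k. exch S j k =
      (if j \<in> set w \<or> k \<in> set w then - exch Q j k
       else exch Q j k +
         (if j \<in> frozen Q \<and> k \<in> frozen Q then 0 else \<Sum>u\<in>set w. through_paths Q u j k)))"
    unfolding S_def by (rule mutate_word_independent) (use Q Cons.prems in auto)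
  then have S: "is_ice_quiver S" "verts S = verts Q" "frozen S = frozen Q"
    and exS: "\<And>j k. exch S j k =
      (if j \<in> set w \<or> k \<in> set w then - exch Q j k
       else exch Q j k +
         (if j \<in> frozen Q \<and> k \<in> frozen Q then 0 else \<Sum>u\<in>set w. through_paths Q u j k))"
    by auto
  have "arrows S f u = 0" if "f \<in> frozen Q" for f
  proof -
    have f: "f \<notin> set w" using that Cons.prems by (auto simp: mutable_def)
    have "(\<Sum>x\<in>set w. through_paths Q x f u) = 0"
      by (rule sum.neutral) (use Cons.prems in \<open>simp add: through_paths_def\<close>)
    then have "exch S f u = exch Q f u" using exS[of f u] f Cons.prems by auto
    moreover have "0 \<le> exch Q u f" using Cons.prems that by simp
    ultimately show ?thesis
      using arrows_eq_exch[OF S(1), of f u] exch_antisym[of Q f u] by simp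
  qed
  then show ?case
    using Cons S by (simp add: S_def[symmetric] green_def mutable_def)
qed

lemma maximal_green_sequence_green_word:
  assumes "green_word (framed Q) (map Inl w)"
    and "\<And>x. x \<in> mutable (mutate_word (map Inl w) (framed Q)) \<Longrightarrow>
      red (mutate_word (map Inl w) (framed Q)) x"
  shows "maximal_green_sequence Q w"
  unfolding maximal_green_sequence_def using assms by (auto simp: green_word_append)

section \<open>Chebyshev polynomials of Dynkin diagrams\<close>

text \<open>The matrix \<open>U\<^sub>t\<^sub>-\<^sub>1(m)\<close>, where \<open>U\<close> is the Chebyshev polynomial with
  \<open>U\<^sub>-\<^sub>1 = 0\<close>, \<open>U\<^sub>0 = 1\<close> and \<open>U\<^sub>t\<^sub>+\<^sub>1 = x U\<^sub>t - U\<^sub>t\<^sub>-\<^sub>1\<close>.\<close>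

fun cheb :: "'a set \<Rightarrow> ('a \<Rightarrow> 'a \<Rightarrow> nat) \<Rightarrow> nat \<Rightarrow> 'a \<Rightarrow> 'a \<Rightarrow> int" where
  "cheb V m 0 v w = 0"
| "cheb V m (Suc 0) v w = (if v = w then 1 else 0)"
| "cheb V m (Suc (Suc t)) v w = (\<Sum>u\<in>V. int (m v u) * cheb V m (Suc t) u w) - cheb V m t v w"

definition dynkin_adj :: "dynkin \<Rightarrow> nat \<Rightarrow> nat \<Rightarrow> nat" where
  "dynkin_adj X i j = (if {i, j} \<in> dynkin_edges X then 1 else 0)"

text \<open>The entries of \<open>U\<^sub>t\<close> of the path \<open>A\<^sub>n\<close> are the \<open>SU(2)\<close> fusion coefficients.\<close>

definition fusion :: "int \<Rightarrow> int \<Rightarrow> int \<Rightarrow> int \<Rightarrow> int" where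
  "fusion n t i j = (if t \<le> i + j \<and> i \<le> t + j \<and> j \<le> t + i \<and> even (t + i + j)
      \<and> t + i + j + 2 \<le> 2 * n then 1 else 0)"

section \<open>Type A: the recurrence for fusion coefficients\<close>

lemma pair_in_path_edges: "{i, j} \<in> path_edges n \<longleftrightarrow> (j = i + 1 \<and> j < n) \<or> (i = j + 1 \<and> i < n)"
  by (auto simp: path_edges_def doubleton_eq_iff)

text \<open>The bound \<open>N\<close> may exceed \<open>n\<close> since in type D the path misses
  one vertex of the diagram.\<close>

lemma sum_path_neighbours:
  fixes f :: "nat \<Rightarrow> int"
  assumes "i < n" "n \<le> N"
  shows "(\<Sum>u<N. (if {i, u} \<in> path_edges n then 1 else 0) * f u) =
    (if 0 < i then f (i - 1) else 0) + (if i + 1 < n then f (i + 1) else 0)"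
proof -
  have "(\<Sum>u<N. (if {i, u} \<in> path_edges n then 1 else 0) * f u) =
     (\<Sum>u<N. (if u = i - 1 then (if 0 < i then f u else 0) else 0) +
             (if u = i + 1 then (if i + 1 < n then f u else 0) else 0))"
    by (rule sum.cong) (use assms in \<open>auto simp: pair_in_path_edges\<close>)
  also have "\<dots> = (if 0 < i then f (i - 1) else 0) + (if i + 1 < n then f (i + 1) else 0)"
    unfolding sum.distrib using assms by (auto simp: sum.delta)
  finally show ?thesis .
qed

lemma fusion_odd: "odd (t + i + j) \<Longrightarrow> fusion n t i j = 0"
  by (simp add: fusion_def)

lemma fusion_even:
  "even (t + i + j) \<Longrightarrow> fusion n t i j =
    (if t \<le> i + j \<and> i \<le> t + j \<and> j \<le> t + i \<and> t + i + j + 2 \<le> 2 * n then 1 else 0)"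
  by (simp add: fusion_def)

text \<open>Multiplication by the two-dimensional representation shifts a weight by one in either
  direction. All four terms vanish when \<open>t + i + j\<close> is even.\<close>

lemma fusion_rec:
  assumes "0 \<le> i" "i < n" "0 \<le> j" "j < n" "0 \<le> t" "t < n"
  shows "fusion n (t + 1) i j = fusion n t (i - 1) j + fusion n t (i + 1) j - fusion n (t - 1) i j"
proof (cases "even (t + i + j)")
  case True
  then have odd: "odd (t + 1 + i + j)" "odd (t - 1 + i + j)" "odd (t + (i - 1) + j)" "odd (t + (i + 1) + j)"
    by presburger+
  show ?thesis by (simp only: odd[THEN fusion_odd] add_0 diff_0_right)
next
  case False
  then have "odd (i + j - t)" by presburger
  \<comment> \<open>Halving through \<open>s\<close> replaces the parity conditions, and each
    indicator becomes a few linear inequalities in \<open>i\<close>, \<open>s\<close>,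
    \<open>t\<close>.\<close>
  then obtain s where s: "i + j - t = 2 * s + 1" by (elim oddE)
  then have j: "j = t + 2 * s + 1 - i" by simp
  have par: "even (t + 1 + i + j)" "even (t - 1 + i + j)" "even (t + (i - 1) + j)" "even (t + (i + 1) + j)"
    using False by presburger+
  have "fusion n (t + 1) i j = (if 0 \<le> s \<and> i \<le> t + s + 1 \<and> s \<le> i \<and> t + s + 2 \<le> n then 1 else 0)"
    unfolding fusion_even[OF par(1)] using s by (intro if_cong refl iffI conjI; elim conjE; linarith)
  moreover have "fusion n (t - 1) i j = (if -1 \<le> s \<and> i \<le> t + s \<and> s + 1 \<le> i \<and> t + s + 1 \<le> n then 1 else 0)"
    unfolding fusion_even[OF par(2)] using s by (intro if_cong refl iffI conjI; elim conjE; linarith)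
  moreover have "fusion n t (i - 1) j = (if 0 \<le> s \<and> i \<le> t + s + 1 \<and> s + 1 \<le> i \<and> t + s + 1 \<le> n then 1 else 0)"
    unfolding fusion_even[OF par(3)] using s by (intro if_cong refl iffI conjI; elim conjE; linarith)
  moreover have "fusion n t (i + 1) j = (if -1 \<le> s \<and> i \<le> t + s \<and> s \<le> i \<and> t + s + 2 \<le> n then 1 else 0)"
    unfolding fusion_even[OF par(4)] using s by (intro if_cong refl iffI conjI; elim conjE; linarith)
  ultimately show ?thesis using assms s by auto
qed

text \<open>Virtual vertices \<open>-1\<close> and \<open>n\<close> beyond the ends of the path let
  the recurrence hold uniformly at the end vertices.\<close>

lemma fusion_boundary:
  assumes "0 \<le> j" "j < n"
  shows "fusion n t (-1) j = 0" "fusion n t n j = 0"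
  using assms by (auto simp: fusion_def)

text \<open>The reflection exchanges the triangle inequality \<open>t \<le> i + j\<close> with the
  truncation bound, and the other two with each other.\<close>

lemma fusion_reflect: "fusion n t (n - 1 - i) (n - 1 - j) = fusion n t i j"
proof -
  have "even (t + (n - 1 - i) + (n - 1 - j)) \<longleftrightarrow> even (t + i + j)" by presburger
  then show ?thesis unfolding fusion_def by (intro if_cong) auto
qed

lemma fusion_minus_one: "fusion n (-1) i j = 0"
  by (auto simp: fusion_def)

lemma fusion_zero: "fusion n 0 i j = (if i = j \<and> 0 \<le> i \<and> i < n then 1 else 0)"
  by (auto simp: fusion_def)

text \<open>The index shift reflects that \<open>cheb\<close> at \<open>t\<close> is the polynomial
  of degree \<open>t - 1\<close>; the range ends at the Coxeter number.\<close>

lemma cheb_type_A: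
  assumes "i < n" "j < n" "t \<le> n + 1"
  shows "cheb {..<n} (dynkin_adj (Type_A n)) t i j = fusion (int n) (int t - 1) (int i) (int j)"
  using assms
proof (induction t arbitrary: i rule: induct_nat_012)
  case 0
  then show ?case by (simp add: fusion_minus_one)
next
  case 1
  then show ?case by (auto simp: fusion_zero)
next
  case (ge2 t)
  let ?F = "\<lambda>t i. fusion (int n) t i (int j)"
  have "cheb {..<n} (dynkin_adj (Type_A n)) (Suc (Suc t)) i j =
    (\<Sum>u<n. (if {i, u} \<in> path_edges n then 1 else 0) * ?F (int t) (int u)) - ?F (int t - 1) (int i)"
  proof -
    have "int (dynkin_adj (Type_A n) i u) = (if {i, u} \<in> path_edges n then 1 else 0)" for u
      by (simp add: dynkin_adj_def)
    then show ?thesis using ge2 by simp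
  qed
  also have "\<dots> = (if 0 < i then ?F (int t) (int i - 1) else 0)
      + (if i + 1 < n then ?F (int t) (int i + 1) else 0) - ?F (int t - 1) (int i)"
    using ge2 by (subst sum_path_neighbours) (auto simp: of_nat_diff add.commute)
  also have "\<dots> = ?F (int t) (int i - 1) + ?F (int t) (int i + 1) - ?F (int t - 1) (int i)"
  proof -
    have "?F (int t) (int i + 1) = 0" if "\<not> i + 1 < n"
    proof -
      have "int i + 1 = int n" using that ge2 by simp
      then show ?thesis using fusion_boundary(2)[of "int j" "int n" "int t"] ge2 by simp
    qed
    moreover have "?F (int t) (int i - 1) = 0" if "i = 0"
      using fusion_boundary(1)[of "int j" "int n" "int t"] that ge2 by simp
    ultimately show ?thesis by simp
  qed
  also have "\<dots> = ?F (int t + 1) (int i)"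
    using fusion_rec[of "int i" "int n" "int j" "int t"] ge2 by simp
  finally show ?case by (simp add: add.commute)
qed

text \<open>
  The diagram \<open>D\<^sub>c\<^sub>+\<^sub>2\<close> is the quotient of the path on \<open>0, \<dots>, 2 c\<close> by its reflection,
  whose fixed vertex \<open>c\<close> splits into the two twins \<open>c\<close> and \<open>c + 1\<close>.
\<close>

definition folded :: "nat \<Rightarrow> int \<Rightarrow> nat \<Rightarrow> nat \<Rightarrow> int" where
  "folded c t i j =
    (let F = (\<lambda>i j. fusion (2 * int c + 1) t i j) in
     if i < c \<and> j < c then F (int i) (int j) + F (int i) (2 * int c - int j)
     else if i < c then F (int i) (int c)
     else if j < c then F (int c) (int j)
     else if 0 \<le> t \<and> t \<le> 2 * int c \<and> t mod 4 = (if i = j then 0 else 2) then 1 else 0)"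

section \<open>Type D: folding a path of odd length\<close>

lemma sum_type_D_neighbours:
  fixes f :: "nat \<Rightarrow> int"
  assumes "i < c + 2" "2 \<le> c"
  shows "(\<Sum>u<c + 2. int (dynkin_adj (Type_D (c + 2)) i u) * f u) =
    (if i < c then (if 0 < i then f (i - 1) else 0) + f (i + 1) + (if i = c - 1 then f (c + 1) else 0)
     else f (c - 1))"
proof -
  \<comment> \<open>The second summand is the edge between the branch vertex \<open>c - 1\<close>
    and the twin \<open>c + 1\<close>; all other edges lie on the path.\<close>
  have adj: "int (dynkin_adj (Type_D (c + 2)) i u) =
      (if {i, u} \<in> path_edges (c + 1) then 1 else 0) +
      (if u = (if i = c - 1 then c + 1 else c - 1) then (if i = c - 1 \<or> i = c + 1 then 1 else 0) else 0)" for u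
    using assms by (auto simp: dynkin_adj_def pair_in_path_edges doubleton_eq_iff)
  have pth: "(\<Sum>u<c + 2. (if {i, u} \<in> path_edges (c + 1) then 1 else 0) * f u) =
    (if i < c + 1 then (if 0 < i then f (i - 1) else 0) + (if i + 1 < c + 1 then f (i + 1) else 0) else 0)"
  proof (cases "i < c + 1")
    case True
    then show ?thesis using sum_path_neighbours[of i "c + 1" "c + 2" f] by simp
  next
    case False
    then show ?thesis by (auto simp: pair_in_path_edges intro!: sum.neutral)
  qed
  have "(\<Sum>u<c + 2. int (dynkin_adj (Type_D (c + 2)) i u) * f u) =
    (\<Sum>u<c + 2. (if {i, u} \<in> path_edges (c + 1) then 1 else 0) * f u) +
    (\<Sum>u<c + 2. if u = (if i = c - 1 then c + 1 else c - 1) then (if i = c - 1 \<or> i = c + 1 then f u else 0) else 0)"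
    unfolding adj distrib_right sum.distrib by (intro arg_cong2[of _ _ _ _ "(+)"] sum.cong refl) auto
  also have "\<dots> = (if i < c then (if 0 < i then f (i - 1) else 0) + f (i + 1) + (if i = c - 1 then f (c + 1) else 0)
     else f (c - 1))"
  proof -
    have "i < c \<or> i = c \<or> i = c + 1" using assms by auto
    then show ?thesis unfolding pth sum.delta[OF finite_lessThan] using assms by auto
  qed
  finally show ?thesis .
qed

lemma folded_simps:
  "i < c \<Longrightarrow> j < c \<Longrightarrow> folded c t i j = fusion (2 * int c + 1) t (int i) (int j)
      + fusion (2 * int c + 1) t (int i) (2 * int c - int j)"
  "i < c \<Longrightarrow> c \<le> j \<Longrightarrow> folded c t i j = fusion (2 * int c + 1) t (int i) (int c)"
  "c \<le> i \<Longrightarrow> j < c \<Longrightarrow> folded c t i j = fusion (2 * int c + 1) t (int c) (int j)"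
  "c \<le> i \<Longrightarrow> c \<le> j \<Longrightarrow> folded c t i j =
      (if 0 \<le> t \<and> t \<le> 2 * int c \<and> t mod 4 = (if i = j then 0 else 2) then 1 else 0)"
  by (simp_all add: folded_def Let_def)

text \<open>Summing over reflection orbits carries \<open>fusion_rec\<close> over to the quotient;
  at the middle, the two neighbours on the path are mirror images. Only the block of the twins needs
  residues modulo 4.\<close>

lemma folded_rec:
  assumes "i < c + 2" "j < c + 2" "2 \<le> c" "0 \<le> t" "t \<le> 2 * int c"
  shows "folded c (t + 1) i j =
    (if i < c then (if 0 < i then folded c t (i - 1) j else 0) + folded c t (i + 1) j
        + (if i = c - 1 then folded c t (c + 1) j else 0)
     else folded c t (c - 1) j) - folded c (t - 1) i j"
proof -
  let ?F = "\<lambda>t i j. fusion (2 * int c + 1) t i j"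
  have rec: "?F (t + 1) a b = ?F t (a - 1) b + ?F t (a + 1) b - ?F (t - 1) a b"
    if "0 \<le> a" "a \<le> 2 * int c" "0 \<le> b" "b \<le> 2 * int c" for a b
    using fusion_rec[of a "2 * int c + 1" b t] that assms by simp
  have reflect: "?F t a (2 * int c - b) = ?F t (2 * int c - a) b" for a b
    using fusion_reflect[of "2 * int c + 1" t "2 * int c - a" b] by simp
  have left: "(if 0 < i then folded c t (i - 1) j else 0) =
      (if j < c then ?F t (int i - 1) (int j) + ?F t (int i - 1) (2 * int c - int j)
       else ?F t (int i - 1) (int c))" if "i < c"
  proof (cases i)
    case 0
    then show ?thesis
      using fusion_boundary(1)[of _ "2 * int c + 1" t] by auto
  next
    case (Suc k)
    then show ?thesis using that by (auto simp: folded_simps)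
  qed
  consider "i + 1 < c" "j < c" | "i + 1 = c" "j < c" | "c \<le> i" "j < c"
    | "i + 1 < c" "c \<le> j" | "i + 1 = c" "c \<le> j" | "c \<le> i" "c \<le> j"
    by linarith
  then show ?thesis
  proof cases
    case 1
    then have "folded c t (i + 1) j = ?F t (int i + 1) (int j) + ?F t (int i + 1) (2 * int c - int j)"
      by (simp add: folded_simps add.commute)
    moreover have "i \<noteq> c - Suc 0" using 1 by simp
    ultimately show ?thesis using 1 left rec[of "int i" "int j"] rec[of "int i" "2 * int c - int j"]
      by (simp add: folded_simps)
  next
    case 2
    have i: "int i + 1 = int c" "i < c" "i = c - 1" "i + 1 = c" using 2 by auto
    have "?F t (int c) (2 * int c - int j) = ?F t (int c) (int j)" using reflect[of "int c" "int j"] by simp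
    then show ?thesis
      using 2 i left rec[of "int i" "int j"] rec[of "int i" "2 * int c - int j"]
      by (simp add: folded_simps)
  next
    case 3
    have "int (c - 1) = int c - 1" "c - 1 < c" using assms by auto
    then show ?thesis using 3 rec[of "int c" "int j"] reflect[of "int c - 1" "int j"]
      by (simp add: folded_simps add.commute)
  next
    case 4
    then have "folded c t (i + 1) j = ?F t (int i + 1) (int c)"
      by (simp add: folded_simps add.commute)
    moreover have "i \<noteq> c - Suc 0" using 4 by simp
    ultimately show ?thesis using 4 left rec[of "int i" "int c"]
      by (simp add: folded_simps)
  next
    case 5
    have i: "int i + 1 = int c" "i < c" "i = c - 1" "i + 1 = c" using 5 by auto
    \<comment> \<open>For even \<open>t\<close> the middle entry is 1, and exactly one twin carries
      it, according to \<open>t mod 4\<close>.\<close>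
    have "?F t (int c) (int c) = folded c t c j + folded c t (c + 1) j"
    proof -
      have even: "even (t + int c + int c) \<longleftrightarrow> t mod 4 = 0 \<or> t mod 4 = 2" by presburger
      have "j = c \<or> j = c + 1" using 5 assms by auto
      then show ?thesis using 5 assms unfolding fusion_def even by (auto simp: folded_simps)
    qed
    then show ?thesis using 5 i left rec[of "int i" "int c"]
      by (simp add: folded_simps)
  next
    case 6
    have L: "folded c t (c - 1) j = (if odd t then 1 else 0)"
    proof -
      have c: "int (c - 1) = int c - 1" "c - 1 < c" using assms by auto
      have even: "even (t + (int c - 1) + int c) \<longleftrightarrow> odd t" by presburger
      have "1 \<le> t \<and> t \<le> 2 * int c - 1" if "odd t" using that assms by presburger
      then show ?thesis
        unfolding folded_simps(2)[OF c(2) 6(2)] c(1) fusion_def even by (cases "even t") auto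
    qed
    \<comment> \<open>For odd \<open>t\<close> the residues of \<open>t + 1\<close> and
      \<open>t - 1\<close> are 0 and 2 in some order, so exactly one of the two twin entries is 1,
      matching \<open>L\<close>.\<close>
    have "1 \<le> t \<and> t \<le> 2 * int c - 1 \<and> ((t + 1) mod 4 = 0 \<and> (t - 1) mod 4 = 2 \<or> (t + 1) mod 4 = 2 \<and> (t - 1) mod 4 = 0)"
      if "odd t" using that assms(4,5) by presburger
    moreover have "odd ((t + 1) mod 4) \<and> odd ((t - 1) mod 4)" if "even t" using that by presburger
    ultimately show ?thesis using 6 L
      by (cases "even t") (auto simp: folded_simps)
  qed
qed

lemma cheb_type_D:
  assumes "i < c + 2" "j < c + 2" "2 \<le> c" "t \<le> 2 * c + 2"
  shows "cheb {..<c + 2} (dynkin_adj (Type_D (c + 2))) t i j = folded c (int t - 1) i j"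
  using assms
proof (induction t arbitrary: i rule: induct_nat_012)
  case 0
  then show ?case by (simp add: folded_def fusion_minus_one)
next
  case 1
  then show ?case by (auto simp: folded_def fusion_zero)
next
  case (ge2 t)
  have "cheb {..<c + 2} (dynkin_adj (Type_D (c + 2))) (Suc (Suc t)) i j =
    (\<Sum>u<c + 2. int (dynkin_adj (Type_D (c + 2)) i u) * folded c (int t) u j) - folded c (int t - 1) i j"
    using ge2 by simp
  also have "\<dots> = folded c (int t + 1) i j"
    using ge2 by (subst sum_type_D_neighbours) (auto simp: folded_rec)
  finally show ?case by (simp add: add.commute)
qed

lemma fusion_nonneg: "0 \<le> fusion n t i j"
  by (simp add: fusion_def)

text \<open>At \<open>t = n\<close> the triangle inequality and the truncation bound are
  incompatible; this is the vanishing at the Coxeter number in types A and D.\<close>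

lemma fusion_top: "i < n \<Longrightarrow> j < n \<Longrightarrow> fusion n n i j = 0"
  by (auto simp: fusion_def)

text \<open>
  In type \<open>E\<close> the finitely many values are computed, column by column: the pair of lists holds two
  consecutive vectors of the recurrence, and \<open>ns\<close> lists the neighbours of each vertex.
\<close>

definition cheb_step :: "nat list list \<Rightarrow> int list \<times> int list \<Rightarrow> int list \<times> int list" where
  "cheb_step ns pc = (snd pc, map2 (\<lambda>l q. sum_list (map ((!) (snd pc)) l) - q) ns (fst pc))"

fun cheb_check :: "nat list list \<Rightarrow> nat \<Rightarrow> int list \<times> int list \<Rightarrow> bool" where
  "cheb_check ns 0 pc \<longleftrightarrow> list_all (\<lambda>x. x = 0) (fst pc)"
| "cheb_check ns (Suc h) pc \<longleftrightarrow> list_all (\<lambda>x. 0 \<le> x) (fst pc) \<and> cheb_check ns h (cheb_step ns pc)"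

definition unit_row :: "nat \<Rightarrow> nat \<Rightarrow> int list" where
  "unit_row n j = map (\<lambda>i. if i = j then 1 else 0) [0..<n]"

definition cheb_check_all :: "nat list list \<Rightarrow> nat \<Rightarrow> bool" where
  "cheb_check_all ns h \<longleftrightarrow>
    list_all (\<lambda>j. cheb_check ns h (replicate (length ns) 0, unit_row (length ns) j)) [0..<length ns]"

text \<open>Invariant: the pair holds column \<open>j\<close> at the indices \<open>s\<close> and
  \<open>Suc s\<close>, and each \<open>cheb_step\<close> raises \<open>s\<close> by one.\<close>

lemma cheb_check_sound:
  assumes nbs: "\<And>i f. i < n \<Longrightarrow> (\<Sum>u<n. int (m i u) * f u) = sum_list (map f (ns ! i))"
    and "length ns = n" and range: "\<And>i u. i < n \<Longrightarrow> u \<in> set (ns ! i) \<Longrightarrow> u < n"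
    and "cheb_check ns h (map (\<lambda>i. cheb {..<n} m s i j) [0..<n], map (\<lambda>i. cheb {..<n} m (Suc s) i j) [0..<n])"
    and "i < n" "s \<le> t" "t \<le> s + h"
  shows "0 \<le> cheb {..<n} m t i j \<and> (t = s + h \<longrightarrow> cheb {..<n} m t i j = 0)"
  using assms(4-)
proof (induction h arbitrary: s)
  case 0
  then show ?case by (simp add: list_all_iff)
next
  case (Suc h)
  have "cheb_step ns (map (\<lambda>i. cheb {..<n} m s i j) [0..<n], map (\<lambda>i. cheb {..<n} m (Suc s) i j) [0..<n])
    = (map (\<lambda>i. cheb {..<n} m (Suc s) i j) [0..<n], map (\<lambda>i. cheb {..<n} m (Suc (Suc s)) i j) [0..<n])"
  proof -
    have "map ((!) (map (\<lambda>i. cheb {..<n} m (Suc s) i j) [0..<n])) (ns ! i) =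
        map (\<lambda>i. cheb {..<n} m (Suc s) i j) (ns ! i)" if "i < n" for i
      by (rule map_cong) (use range that in auto)
    then have "sum_list (map ((!) (map (\<lambda>i. cheb {..<n} m (Suc s) i j) [0..<n])) (ns ! i)) =
        (\<Sum>u<n. int (m i u) * cheb {..<n} m (Suc s) u j)" if "i < n" for i
      using nbs that by metis
    then show ?thesis
      unfolding cheb_step_def by (auto intro!: nth_equalityI simp: assms(2))
  qed
  then have "cheb_check ns h (map (\<lambda>i. cheb {..<n} m (Suc s) i j) [0..<n],
      map (\<lambda>i. cheb {..<n} m (Suc (Suc s)) i j) [0..<n])"
    using Suc.prems by simp
  then have "0 \<le> cheb {..<n} m t i j \<and> (t = Suc s + h \<longrightarrow> cheb {..<n} m t i j = 0)" if "s \<noteq> t"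
    using Suc.IH[of "Suc s"] Suc.prems that by simp
  moreover have "0 \<le> cheb {..<n} m s i j"
    using Suc.prems by (simp add: list_all_iff)
  ultimately show ?case by auto
qed

lemma cheb_check_all_sound:
  assumes "\<And>i f. i < n \<Longrightarrow> (\<Sum>u<n. int (m i u) * f u) = sum_list (map f (ns ! i))"
    and n: "length ns = n" and "\<And>i u. i < n \<Longrightarrow> u \<in> set (ns ! i) \<Longrightarrow> u < n"
    and "cheb_check_all ns h" and "i < n" "j < n" "t \<le> h"
  shows "0 \<le> cheb {..<n} m t i j \<and> (t = h \<longrightarrow> cheb {..<n} m t i j = 0)"
proof -
  have "map (\<lambda>i. cheb {..<n} m 0 i j) [0..<n] = replicate n 0"
    by (simp add: map_replicate_trivial[symmetric] list_eq_iff_nth_eq)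
  moreover have "map (\<lambda>i. cheb {..<n} m (Suc 0) i j) [0..<n] = unit_row n j"
    by (simp add: unit_row_def)
  ultimately show ?thesis
    using cheb_check_sound[of n m ns h 0 j i t] assms
    by (simp add: cheb_check_all_def list_all_iff)
qed

lemma cheb_dynkin:
  assumes X: "valid_dynkin X" and i: "i < rank X" and j: "j < rank X" and t: "t \<le> coxeter_number X"
  shows "0 \<le> cheb {..<rank X} (dynkin_adj X) t i j \<and>
    (t = coxeter_number X \<longrightarrow> cheb {..<rank X} (dynkin_adj X) t i j = 0)"
proof (cases X)
  case (Type_A n)
  then show ?thesis using assms by (auto simp: cheb_type_A fusion_nonneg fusion_top)
next
  case (Type_D n)
  define c where "c = n - 2"
  have n: "n = c + 2" "2 \<le> c" using X Type_D by (auto simp: c_def)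
  have "0 \<le> folded c s i j" for s
    by (simp add: folded_def Let_def fusion_nonneg)
  moreover have "folded c (2 * int c + 1) i j = 0"
    by (simp add: folded_def Let_def fusion_top)
  moreover have "cheb {..<c + 2} (dynkin_adj (Type_D (c + 2))) t i j = folded c (int t - 1) i j"
    by (rule cheb_type_D) (use assms Type_D n in auto)
  ultimately show ?thesis using n(1) Type_D by (auto simp: algebra_simps)
next
  case Type_E6
  let ?ns = "[[1], [0,2], [1,3,5], [2,4], [3], [2]] :: nat list list"
  have "cheb_check_all ?ns 12" by code_simp
  moreover have "k \<in> {0, 1, 2, 3, 4, 5}" if "k < 6" for k :: nat using that by auto
  ultimately show ?thesis unfolding Type_E6 using assms Type_E6
    by (intro cheb_check_all_sound[of _ _ ?ns])
       (fastforce simp: dynkin_adj_def pair_in_path_edges doubleton_eq_iff eval_nat_numeral lessThan_Suc)+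
next
  case Type_E7
  let ?ns = "[[1], [0,2], [1,3,6], [2,4], [3,5], [4], [2]] :: nat list list"
  have "cheb_check_all ?ns 18" by code_simp
  moreover have "k \<in> {0, 1, 2, 3, 4, 5, 6}" if "k < 7" for k :: nat using that by auto
  ultimately show ?thesis unfolding Type_E7 using assms Type_E7
    by (intro cheb_check_all_sound[of _ _ ?ns])
       (fastforce simp: dynkin_adj_def pair_in_path_edges doubleton_eq_iff eval_nat_numeral lessThan_Suc)+
next
  case Type_E8
  let ?ns = "[[1], [0,2], [1,3,7], [2,4], [3,5], [4,6], [5], [2]] :: nat list list"
  have "cheb_check_all ?ns 30" by code_simp
  moreover have "k \<in> {0, 1, 2, 3, 4, 5, 6, 7}" if "k < 8" for k :: nat using that by auto
  ultimately show ?thesis unfolding Type_E8 using assms Type_E8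
    by (intro cheb_check_all_sound[of _ _ ?ns])
       (fastforce simp: dynkin_adj_def pair_in_path_edges doubleton_eq_iff eval_nat_numeral lessThan_Suc)+
qed

section \<open>Equality of Coxeter numbers\<close>

text \<open>A polynomial in \<open>m\<close> commutes with every matrix that commutes with
  \<open>m\<close>.\<close>

lemma cheb_commute:
  fixes m m' :: "'a \<Rightarrow> 'a \<Rightarrow> nat"
  assumes V: "finite V" and comm: "\<And>v w. v \<in> V \<Longrightarrow> w \<in> V \<Longrightarrow>
      (\<Sum>u\<in>V. int (m v u) * int (m' u w)) = (\<Sum>u\<in>V. int (m' v u) * int (m u w))"
    and "v \<in> V" "w \<in> V"
  shows "(\<Sum>u\<in>V. cheb V m t v u * int (m' u w)) = (\<Sum>u\<in>V. int (m' v u) * cheb V m t u w)"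
  using assms(3,4)
proof (induction t arbitrary: v w rule: induct_nat_012)
  case 0
  then show ?case by simp
next
  case 1
  then show ?case using V
    by (simp add: if_distrib if_distribR sum.delta sum.delta' cong: if_cong)
next
  case (ge2 t)
  let ?c = "cheb V m"
  have "(\<Sum>u\<in>V. ?c (Suc (Suc t)) v u * int (m' u w)) =
      (\<Sum>u\<in>V. \<Sum>x\<in>V. int (m v x) * ?c (Suc t) x u * int (m' u w)) - (\<Sum>u\<in>V. ?c t v u * int (m' u w))"
    by (simp add: left_diff_distrib sum_subtractf sum_distrib_right)
  also have "(\<Sum>u\<in>V. \<Sum>x\<in>V. int (m v x) * ?c (Suc t) x u * int (m' u w)) =
      (\<Sum>x\<in>V. int (m v x) * (\<Sum>u\<in>V. ?c (Suc t) x u * int (m' u w)))"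
    by (subst sum.swap) (simp add: sum_distrib_left mult.assoc)
  also have "\<dots> = (\<Sum>x\<in>V. int (m v x) * (\<Sum>u\<in>V. int (m' x u) * ?c (Suc t) u w))"
    using ge2 by (intro sum.cong) auto
  also have "\<dots> = (\<Sum>u\<in>V. \<Sum>x\<in>V. int (m v x) * int (m' x u) * ?c (Suc t) u w)"
    by (subst sum.swap) (simp add: sum_distrib_left mult.assoc)
  also have "\<dots> = (\<Sum>u\<in>V. (\<Sum>x\<in>V. int (m' v x) * int (m x u)) * ?c (Suc t) u w)"
    using ge2 comm by (intro sum.cong) (auto simp flip: sum_distrib_right)
  also have "\<dots> = (\<Sum>x\<in>V. \<Sum>u\<in>V. int (m' v x) * int (m x u) * ?c (Suc t) u w)"
    by (subst sum.swap) (simp add: sum_distrib_right)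
  also have "(\<Sum>u\<in>V. ?c t v u * int (m' u w)) = (\<Sum>u\<in>V. int (m' v u) * ?c t u w)"
    using ge2 by simp
  finally show ?case
    by (simp add: right_diff_distrib sum_subtractf sum_distrib_left mult.assoc)
qed

text \<open>After a zero row the recurrence would produce the negative of the last nonzero row,
  against nonnegativity.\<close>

lemma cheb_row_nonzero:
  assumes V: "finite V" and v: "v \<in> V" and "1 \<le> t" "t < h"
    and nonneg: "\<And>s w. s \<le> h \<Longrightarrow> w \<in> V \<Longrightarrow> 0 \<le> cheb V m s v w"
  shows "\<exists>w\<in>V. cheb V m t v w \<noteq> 0"
  using assms(3,4)
proof (induction t rule: dec_induct)
  case base
  then show ?case using v by auto
next
  case (step t)
  show ?case
  proof (rule ccontr)
    assume "\<not> ?thesis"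
    then have zero: "cheb V m (Suc t) v u = 0" if "u \<in> V" for u using that by blast
    obtain w where w: "w \<in> V" "cheb V m t v w \<noteq> 0" using step by auto
    \<comment> \<open>Commutation with \<open>m\<close> itself moves the factor to the right, so
      that only row \<open>v\<close> occurs.\<close>
    have "cheb V m (Suc (Suc t)) v w = (\<Sum>u\<in>V. cheb V m (Suc t) v u * int (m u w)) - cheb V m t v w"
      using cheb_commute[OF V, of m m v w "Suc t"] v w by simp
    then have "cheb V m (Suc (Suc t)) v w = - cheb V m t v w" using zero by simp
    moreover have "0 \<le> cheb V m (Suc (Suc t)) v w" "0 \<le> cheb V m t v w"
      using nonneg[of "Suc (Suc t)" w] nonneg[of t w] step.hyps step.prems w(1) by simp_all
    ultimately show False using w by simp
  qed
qed

section \<open>Reduction to connected components\<close>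

lemma cheb_off_component:
  assumes "C \<subseteq> V" and "\<And>v u. v \<in> C \<Longrightarrow> u \<in> V \<Longrightarrow> m v u \<noteq> 0 \<Longrightarrow> u \<in> C"
    and "v \<in> C" "w \<notin> C"
  shows "cheb V m t v w = 0"
  using assms(3)
proof (induction t arbitrary: v rule: induct_nat_012)
  case (ge2 t)
  have "(\<Sum>u\<in>V. int (m v u) * cheb V m (Suc t) u w) = 0"
  proof (intro sum.neutral ballI)
    fix u assume "u \<in> V"
    then show "int (m v u) * cheb V m (Suc t) u w = 0"
      using ge2 assms(2)[of v u] by (cases "m v u = 0") auto
  qed
  then show ?case using ge2 by simp
qed (use assms(4) in auto)

lemma cheb_component:
  assumes V: "finite V" "C \<subseteq> V" and closed: "\<And>v u. v \<in> C \<Longrightarrow> u \<in> V \<Longrightarrow> m v u \<noteq> 0 \<Longrightarrow> u \<in> C"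
    and bij: "bij_betw \<phi> {..<n} C"
    and m: "\<And>i j. i < n \<Longrightarrow> j < n \<Longrightarrow> m (\<phi> i) (\<phi> j) = m' i j"
    and "i < n" "j < n"
  shows "cheb V m t (\<phi> i) (\<phi> j) = cheb {..<n} m' t i j"
  using assms(6)
proof (induction t arbitrary: i rule: induct_nat_012)
  case 1
  then show ?case using bij \<open>j < n\<close> by (auto simp: bij_betw_def inj_on_def)
next
  case (ge2 t)
  have im: "\<phi> ` {..<n} = C" "inj_on \<phi> {..<n}" using bij by (auto simp: bij_betw_def)
  then have i: "\<phi> i \<in> C" using ge2 by auto
  have "(\<Sum>u\<in>V. int (m (\<phi> i) u) * cheb V m (Suc t) u (\<phi> j)) =
      (\<Sum>u\<in>C. int (m (\<phi> i) u) * cheb V m (Suc t) u (\<phi> j))"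
    using V closed[OF i] by (intro sum.mono_neutral_right) auto
  also have "\<dots> = (\<Sum>u<n. int (m (\<phi> i) (\<phi> u)) * cheb V m (Suc t) (\<phi> u) (\<phi> j))"
    unfolding im(1)[symmetric] using im(2) by (simp add: sum.reindex)
  also have "\<dots> = (\<Sum>u<n. int (m' i u) * cheb {..<n} m' (Suc t) u j)"
    using ge2 m by (intro sum.cong) auto
  finally show ?case using ge2 by simp
qed simp

lemma reachability_refl: "v \<in> V \<Longrightarrow> (v, v) \<in> reachability V m"
  by (simp add: reachability_def)

lemma component_closed:
  assumes "C \<in> components V m"
  shows "C \<subseteq> V" "C \<noteq> {}" "v \<in> C \<Longrightarrow> u \<in> V \<Longrightarrow> m v u \<noteq> 0 \<Longrightarrow> u \<in> C"
proof -
  obtain x where x: "x \<in> V" "C = reachability V m `` {x}"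
    using assms by (auto simp: components_def elim: quotientE)
  then show "C \<subseteq> V" by (auto simp: reachability_def)
  show "C \<noteq> {}" using x reachability_refl[of x V m] by auto
  show "u \<in> C" if "v \<in> C" "u \<in> V" "m v u \<noteq> 0"
    using that x by (auto simp: reachability_def intro: rtrancl_into_rtrancl)
qed

lemma in_component:
  assumes "v \<in> V"
  obtains C where "C \<in> components V m" "v \<in> C"
  using assms reachability_refl[of v V m] by (auto simp: components_def intro: quotientI)

lemma cheb_ADE_component:
  assumes V: "finite V" and C: "C \<in> components V m" "has_dynkin_type m C X"
    and "v \<in> C" "t \<le> coxeter_number X"
  shows "0 \<le> cheb V m t v w \<and> (t = coxeter_number X \<longrightarrow> cheb V m t v w = 0)"
proof (cases "w \<in> C")
  case False
  then show ?thesis using cheb_off_component[of C V m v w t] component_closed[OF C(1)] assms by auto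
next
  case True
  obtain \<phi> where bij: "bij_betw \<phi> {..<rank X} C" and X: "valid_dynkin X"
    and m: "\<And>i j. i < rank X \<Longrightarrow> j < rank X \<Longrightarrow> m (\<phi> i) (\<phi> j) = dynkin_adj X i j"
    using C(2) by (auto simp: has_dynkin_type_def dynkin_adj_def)
  obtain i j where "i < rank X" "j < rank X" "v = \<phi> i" "w = \<phi> j"
    using bij True \<open>v \<in> C\<close> by (auto simp: bij_betw_def)
  moreover have "cheb V m t (\<phi> i) (\<phi> j) = cheb {..<rank X} (dynkin_adj X) t i j"
    by (rule cheb_component[where C = C])
      (use V bij m component_closed(1,3)[OF C(1)] \<open>i < rank X\<close> \<open>j < rank X\<close> in auto)
  ultimately show ?thesis
    using cheb_dynkin[OF X, of i j t] assms(5) by metis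
qed

lemma coxeter_number_ge_2: "valid_dynkin X \<Longrightarrow> 2 \<le> coxeter_number X"
  by (cases X) auto

lemma connected_closed_subset:
  assumes "(x, y) \<in> reachability V m" "x \<in> S"
    and "\<And>u v. u \<in> S \<Longrightarrow> u \<in> V \<Longrightarrow> v \<in> V \<Longrightarrow> m u v \<noteq> 0 \<Longrightarrow> v \<in> S"
  shows "y \<in> S"
proof -
  have "(x, y) \<in> {(x, y). x \<in> V \<and> y \<in> V \<and> m x y \<noteq> 0}\<^sup>*"
    using assms(1) by (simp add: reachability_def)
  then show ?thesis
    by (induction) (use assms in auto)
qed

text \<open>
  The vertices with minimal Coxeter number \<open>h\<close> are closed under \<open>m'\<close>: since \<open>U\<^sub>h\<^sub>-\<^sub>1(m)\<close> commutes
  with \<open>m'\<close> and is nonnegative everywhere by minimality of \<open>h\<close>, a zero row forces zero rows at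
  all \<open>m'\<close>-neighbours.
\<close>

lemma coxeter_numbers_equal:
  fixes m m' :: "'a \<Rightarrow> 'a \<Rightarrow> nat"
  assumes V: "finite V"
    and comm: "\<And>v w. v \<in> V \<Longrightarrow> w \<in> V \<Longrightarrow>
      (\<Sum>u\<in>V. int (m v u) * int (m' u w)) = (\<Sum>u\<in>V. int (m' v u) * int (m u w))"
    and conn: "reachability V (\<lambda>i j. m i j + m' i j) = V \<times> V"
    and ADE: "all_components_ADE V m"
    and C: "C \<in> components V m" "has_dynkin_type m C X"
    and D: "D \<in> components V m" "has_dynkin_type m D Y"
  shows "coxeter_number X = coxeter_number Y"
proof -
  \<comment> \<open>A relation rather than a function, since uniqueness of the Coxeter number at a
    vertex is only shown in \<open>unique\<close>, from the first index at which the row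
    vanishes.\<close>
  define good where "good h v \<longleftrightarrow> (\<exists>C X. C \<in> components V m \<and> has_dynkin_type m C X \<and> v \<in> C \<and> coxeter_number X = h)" for h v
  have ex: "\<exists>h. good h v" if "v \<in> V" for v
    using in_component[OF that, of m] ADE unfolding good_def all_components_ADE_def by metis
  have good2: "2 \<le> h" if "good h v" for h v
    using that coxeter_number_ge_2 by (auto simp: good_def has_dynkin_type_def)
  have nonneg: "0 \<le> cheb V m t v w" if "good h v" "t \<le> h" for h v t w
    using cheb_ADE_component[OF V, of _ m _ v t w] that by (auto simp: good_def)
  have zero: "cheb V m h v w = 0" if "good h v" for h v w
    using cheb_ADE_component[OF V, of _ m _ v h w] that by (auto simp: good_def)
  have good_V: "v \<in> V" if "good h v" for h v
    using that component_closed(1) by (auto simp: good_def)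
  have unique: "h \<le> h'" if v: "good h v" and v': "good h' v" for h h' v
  proof (rule ccontr)
    assume "\<not> h \<le> h'"
    then obtain w where "cheb V m h' v w \<noteq> 0"
      using cheb_row_nonzero[OF V good_V[OF v], of h' h m] nonneg[OF v] good2[OF v'] by auto
    then show False using zero[OF v'] by simp
  qed
  obtain x where x: "x \<in> C" using component_closed(2)[OF C(1)] by auto
  then have gx: "good (coxeter_number X) x" using C by (auto simp: good_def)
  define h where "h = (LEAST h. \<exists>v. good h v)"
  have "\<exists>v. good h v" unfolding h_def by (rule LeastI_ex) (use gx in blast)
  then obtain v where v: "good h v" ..
  have least: "h \<le> h'" if "good h' v" for h' v
    unfolding h_def by (rule Least_le) (use that in blast)
  have step: "good h w" if u: "good h u" and w: "w \<in> V" and uw: "m u w + m' u w \<noteq> 0" for u w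
  proof (cases "m u w = 0")
    case False
    then show ?thesis using u w component_closed(3) by (fastforce simp: good_def)
  next
    case True
    obtain h' where h': "good h' w" using ex[OF w] ..
    have "h' \<le> h"
    proof (rule ccontr)
      assume "\<not> h' \<le> h"
      then obtain y where y: "y \<in> V" "cheb V m h w y \<noteq> 0"
        using cheb_row_nonzero[OF V w, of h h' m] nonneg[OF h'] good2[OF u] by auto
      have ge: "0 \<le> cheb V m h z y" if "z \<in> V" for z
        using ex[OF that] least nonneg by blast
      have "(\<Sum>z\<in>V. int (m' u z) * cheb V m h z y) = (\<Sum>z\<in>V. cheb V m h u z * int (m' z y))"
        using cheb_commute[OF V comm good_V[OF u] y(1), of h] by simp
      also have "\<dots> = 0" using zero[OF u] by simp
      finally have "\<forall>z\<in>V. int (m' u z) * cheb V m h z y = 0"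
        using V ge by (subst (asm) sum_nonneg_eq_0_iff) auto
      then show False using w y uw True by auto
    qed
    then show ?thesis using least[OF h'] h' by simp
  qed
  have all: "good h y" if "y \<in> V" for y
    using connected_closed_subset[of v y V "\<lambda>i j. m i j + m' i j" "Collect (good h)"]
      step v good_V[OF v] conn that by auto
  obtain y where y: "y \<in> D" using component_closed(2)[OF D(1)] by auto
  then have gy: "good (coxeter_number Y) y" using D by (auto simp: good_def)
  have "coxeter_number X = h" "coxeter_number Y = h"
    using unique gx gy all[OF good_V[OF gx]] all[OF good_V[OF gy]] by (simp_all add: order_antisym)
  then show ?thesis by simp
qed

section \<open>Bipartite mutation of the framed quiver\<close>

text \<open>
  With \<open>x\<^sub>t\<close> the c-vectors of the colour about to be mutated at half-step \<open>t\<close>, mutation gives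
  \<open>x\<^sub>t\<^sub>+\<^sub>1 = m x\<^sub>t - x\<^sub>t\<^sub>-\<^sub>1\<close>; below \<open>x\<^sub>t\<close> is \<open>half_step_vec (t + 1)\<close>, and the value \<open>-1\<close> at \<open>0\<close>
  encodes the initial c-vectors of the colour that is not mutated first.
\<close>

definition half_step_vec :: "'a set \<Rightarrow> ('a \<Rightarrow> 'a \<Rightarrow> nat) \<Rightarrow> nat \<Rightarrow> 'a \<Rightarrow> 'a \<Rightarrow> int" where
  "half_step_vec V m t v w = (case t of 0 \<Rightarrow> if v = w then -1 else 0 | Suc s \<Rightarrow> cheb V m (Suc s) v w + cheb V m s v w)"

text \<open>Sums of consecutive Chebyshev matrices inherit the recurrence. The value at 0 fits
  because \<open>U\<close> extends backwards to minus the identity at index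
  \<open>-2\<close>.\<close>

lemma half_step_vec_rec:
  "half_step_vec V m (Suc (Suc t)) v w = (\<Sum>u\<in>V. int (m v u) * half_step_vec V m (Suc t) u w) - half_step_vec V m t v w"
  by (cases t) (simp_all add: half_step_vec_def distrib_left sum.distrib)

definition turn :: "'v list \<Rightarrow> 'v list \<Rightarrow> nat \<Rightarrow> 'v list" where
  "turn ws bs t = (if even t then ws else bs)"

text \<open>Later half-steps go to the front, as words act from right to left.\<close>

fun half_steps :: "'v list \<Rightarrow> 'v list \<Rightarrow> nat \<Rightarrow> 'v list" where
  "half_steps ws bs 0 = []"
| "half_steps ws bs (Suc t) = turn ws bs t @ half_steps ws bs t"

lemma half_steps_even: "half_steps ws bs (2 * k) = word_power (bs @ ws) k"
  by (induction k) (simp_all add: word_power_def turn_def)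

lemma framed_simps [simp]:
  "verts (framed Q) = verts Q <+> verts Q" "frozen (framed Q) = Inr ` verts Q"
  "arrows (framed Q) = framed_arrows Q"
  by (simp_all add: framed_def)

lemma is_ice_quiver_framed:
  assumes "is_quiver Q"
  shows "is_ice_quiver (framed Q)"
proof -
  have *: "finite (verts Q)" "\<And>i. arrows Q i i = 0" "\<And>i j. arrows Q i j = 0 \<or> arrows Q j i = 0"
    "\<And>i j. arrows Q i j \<noteq> 0 \<Longrightarrow> i \<in> verts Q \<and> j \<in> verts Q"
    using assms by (auto simp: is_quiver_def is_ice_quiver_def)
  have "framed_arrows Q x y \<noteq> 0 \<Longrightarrow> x \<in> verts Q <+> verts Q \<and> y \<in> verts Q <+> verts Q" for x y
    using *(4) by (cases "(Q, x, y)" rule: framed_arrows.cases) (auto split: if_splits)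
  moreover have "framed_arrows Q x x = 0" for x
    using * by (cases x) auto
  moreover have "framed_arrows Q x y = 0 \<or> framed_arrows Q y x = 0" for x y
    using *(3) by (cases x; cases y) auto
  ultimately show ?thesis
    using *(1) unfolding is_ice_quiver_def by auto
qed

locale recurrent_quiver =
  fixes Q :: "'v ice_quiver" and \<epsilon> :: "'v \<Rightarrow> nat" and ws bs :: "'v list"
  assumes quiver: "is_quiver Q" and bip: "bipartition Q \<epsilon>"
    and ws: "enumerates ws (white Q \<epsilon>)" and bs: "enumerates bs (black Q \<epsilon>)"
    and rec: "recurrent Q ws bs"
begin

abbreviation "\<Gamma> \<equiv> Gamma Q \<epsilon>"
abbreviation "\<Delta> \<equiv> Delta Q \<epsilon>"
abbreviation "colour t \<equiv> set (turn ws bs t)"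

lemma ice: "is_ice_quiver Q" and frozen_empty [simp]: "frozen Q = {}" and fin: "finite (verts Q)"
  using quiver by (auto simp: is_quiver_def is_ice_quiver_def)

lemma sets [simp]: "set ws = white Q \<epsilon>" "set bs = black Q \<epsilon>" "distinct ws" "distinct bs"
  using ws bs by (auto simp: enumerates_def)

lemma colour: "colour t = (if even t then white Q \<epsilon> else black Q \<epsilon>)"
  by (simp add: turn_def)

lemma distinct_turn: "distinct (turn ws bs t)"
  by (simp add: turn_def)

lemma colour_verts: "colour t \<subseteq> verts Q"
  by (auto simp: colour white_def black_def)

lemma colour_Suc: "v \<in> verts Q \<Longrightarrow> v \<in> colour (Suc t) \<longleftrightarrow> v \<notin> colour t"
  using bip by (auto simp: colour white_def black_def bipartition_def)

lemma arrows_colour: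
  assumes "arrows Q i j \<noteq> 0"
  shows "i \<in> verts Q" "j \<in> verts Q" "j \<in> colour t \<longleftrightarrow> i \<notin> colour t"
proof -
  show v: "i \<in> verts Q" "j \<in> verts Q" using ice assms by (auto simp: is_ice_quiver_def)
  have "\<epsilon> i \<noteq> \<epsilon> j" "\<epsilon> i = 0 \<or> \<epsilon> i = 1" "\<epsilon> j = 0 \<or> \<epsilon> j = 1"
    using bip assms v by (auto simp: bipartition_def)
  then show "j \<in> colour t \<longleftrightarrow> i \<notin> colour t"
    using v by (auto simp: colour white_def black_def)
qed

lemma exch_zero: "i \<notin> colour t \<Longrightarrow> j \<notin> colour t \<Longrightarrow> exch Q i j = 0"
  using arrows_colour(3)[of i j t] arrows_colour(3)[of j i t] by (fastforce simp: exch_def)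

text \<open>Two vertices outside the mutated colour are non-adjacent both in \<open>Q\<close> and in
  its opposite, so by recurrence the paths added between them must cancel.\<close>

lemma through_paths_cancel:
  assumes "i \<notin> colour t" "j \<notin> colour t"
  shows "(\<Sum>u\<in>colour t. through_paths Q u i j) = 0"
proof -
  have "exch (mutate_word (turn ws bs t) Q) i j = exch Q i j + (\<Sum>u\<in>colour t. through_paths Q u i j)"
  proof -
    have "arrows Q u v = 0" if "u \<in> colour t" "v \<in> colour t" for u v
      using arrows_colour(3)[of u v t] that by auto
    then show ?thesis
      using mutate_word_independent[OF ice distinct_turn, of t] colour_verts assms
      by (simp add: mutable_def)
  qed
  moreover have "mutate_word (turn ws bs t) Q = op_quiver Q"
    using rec by (simp add: turn_def recurrent_def)
  moreover have "exch (op_quiver Q) i j = - exch Q i j"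
    by (simp add: exch_def op_quiver_def)
  ultimately show ?thesis using exch_zero[OF assms] by simp
qed

text \<open>Since the quiver is reversed at odd \<open>t\<close>, this says that
  \<open>\<Gamma>\<close> counts the arrows into the vertices about to be mutated at every
  half-step.\<close>

lemma Gamma_colour: "v \<notin> colour t \<Longrightarrow> u \<in> colour t \<Longrightarrow>
    \<Gamma> v u = (if even t then arrows Q v u else arrows Q u v)"
  using arrows_colour(1,2)[of u v] arrows_colour(1,2)[of v u]
  by (auto simp: colour Gamma_def undirected_def Gamma_dir_def white_def black_def)
     (use bip in \<open>fastforce simp: bipartition_def\<close>)+

lemma Delta_colour: "v \<notin> colour t \<Longrightarrow> u \<in> colour t \<Longrightarrow>
    \<Delta> v u = (if even t then arrows Q u v else arrows Q v u)"
  using arrows_colour(1,2)[of u v] arrows_colour(1,2)[of v u]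
  by (auto simp: colour Delta_def undirected_def Delta_dir_def white_def black_def)
     (use bip in \<open>fastforce simp: bipartition_def\<close>)+

lemma Gamma_Delta_sym: "\<Gamma> v u = \<Gamma> u v" "\<Delta> v u = \<Delta> u v"
  by (simp_all add: Gamma_def Delta_def undirected_def)

lemma Gamma_Delta_same_colour:
  assumes "v \<in> colour t \<longleftrightarrow> u \<in> colour t"
  shows "\<Gamma> v u = 0" "\<Delta> v u = 0"
  using assms arrows_colour(3)[of u v t] arrows_colour(3)[of v u t]
  by (auto simp: Gamma_def Delta_def undirected_def Gamma_dir_def Delta_dir_def)

lemma Gamma_plus_Delta: "\<Gamma> i j + \<Delta> i j = undirected (arrows Q) i j"
  using arrows_colour(1,2)[of i j] arrows_colour(1,2)[of j i]
    arrows_colour(3)[of i j 0] arrows_colour(3)[of j i 0] colour_Suc[of i 0] colour_Suc[of j 0]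
  by (auto simp: colour Gamma_def Delta_def undirected_def Gamma_dir_def Delta_dir_def)

text \<open>Each edge changes the colour, so only entries within one colour matter; there the
  commutator is, up to sign, the net path count that recurrence makes zero.\<close>

lemma Gamma_Delta_commute:
  assumes "v \<in> verts Q" "w \<in> verts Q"
  shows "(\<Sum>u\<in>verts Q. int (\<Gamma> v u) * int (\<Delta> u w)) = (\<Sum>u\<in>verts Q. int (\<Delta> v u) * int (\<Gamma> u w))"
proof (cases "v \<in> colour 0 \<longleftrightarrow> w \<in> colour 0")
  case False
  have "int (\<Gamma> v u) * int (\<Delta> u w) = 0" "int (\<Delta> v u) * int (\<Gamma> u w) = 0" for u
    using Gamma_Delta_same_colour[of v 0 u] Gamma_Delta_same_colour[of u 0 w] False
    by (cases "u \<in> colour 0"; cases "v \<in> colour 0"; simp)+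
  then show ?thesis by (simp only: sum.neutral_const)
next
  case True
  then obtain t where t: "v \<notin> colour t" "w \<notin> colour t"
    using colour_Suc[of v 0] colour_Suc[of w 0] assms by metis
  have "(\<Sum>u\<in>verts Q. int (\<Gamma> v u) * int (\<Delta> u w) - int (\<Delta> v u) * int (\<Gamma> u w)) =
      (\<Sum>u\<in>colour t. int (\<Gamma> v u) * int (\<Delta> u w) - int (\<Delta> v u) * int (\<Gamma> u w))"
    using fin colour_verts Gamma_Delta_same_colour[of v t] t
    by (intro sum.mono_neutral_right) auto
  also have "\<dots> = (\<Sum>u\<in>colour t. (if even t then 1 else -1) * through_paths Q u v w)"
    using Gamma_colour[OF t(1)] Gamma_colour[OF t(2)] Delta_colour[OF t(1)] Delta_colour[OF t(2)]
    by (intro sum.cong) (auto simp: through_paths_def Gamma_Delta_sym[of _ w])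
  also have "\<dots> = 0"
    using through_paths_cancel[OF t] by (simp flip: sum_distrib_left)
  finally show ?thesis by (simp add: sum_subtractf)
qed

text \<open>Nonnegativity at earlier half-steps is what makes every mutated vertex green and
  determines which paths to frozen vertices arise.\<close>

lemma half_step_state:
  assumes "\<And>s v w. s < t \<Longrightarrow> v \<in> verts Q \<Longrightarrow> w \<in> verts Q \<Longrightarrow> 0 \<le> half_step_vec (verts Q) \<Gamma> (Suc s) v w"
  defines "S \<equiv> \<lambda>t. mutate_word (map Inl (half_steps ws bs t)) (framed Q)"
  shows "is_ice_quiver (S t) \<and> verts (S t) = verts Q <+> verts Q \<and> frozen (S t) = Inr ` verts Q \<and>
    (\<forall>i j. exch (S t) (Inl i) (Inl j) = (if even t then exch Q i j else - exch Q i j)) \<and>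
    (\<forall>v\<in>verts Q. \<forall>w\<in>verts Q. exch (S t) (Inl v) (Inr w) =
      (if v \<in> colour t then half_step_vec (verts Q) \<Gamma> (Suc t) v w else - half_step_vec (verts Q) \<Gamma> t v w)) \<and>
    green_word (framed Q) (map Inl (half_steps ws bs t))"
  using assms(1)
proof (induction t)
  case 0
  then show ?case
    using is_ice_quiver_framed[OF quiver] by (simp add: S_def exch_def half_step_vec_def)
next
  case (Suc t)
  let ?V = "verts Q" and ?w = "map Inl (turn ws bs t) :: ('v + 'v) list"
  have S: "is_ice_quiver (S t)" "verts (S t) = ?V <+> ?V" "frozen (S t) = Inr ` ?V"
    and quiv: "\<And>i j. exch (S t) (Inl i) (Inl j) = (if even t then exch Q i j else - exch Q i j)"
    and cvec: "\<And>v w. v \<in> ?V \<Longrightarrow> w \<in> ?V \<Longrightarrow> exch (S t) (Inl v) (Inr w) =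
      (if v \<in> colour t then half_step_vec ?V \<Gamma> (Suc t) v w else - half_step_vec ?V \<Gamma> t v w)"
    and green: "green_word (framed Q) (map Inl (half_steps ws bs t))"
    using Suc by auto
  have nonneg: "0 \<le> half_step_vec ?V \<Gamma> (Suc t) v w" if "v \<in> ?V" "w \<in> ?V" for v w
    using Suc.prems that by simp
  have dist: "distinct ?w" and setw: "set ?w = Inl ` colour t"
    by (simp_all add: distinct_map distinct_turn)
  have mut: "set ?w \<subseteq> mutable (S t)"
    using colour_verts by (auto simp: mutable_def S)
  have arr: "arrows (S t) (Inl i) (Inl j) = (if even t then arrows Q i j else arrows Q j i)" for i j
    unfolding arrows_eq_exch[OF S(1)] quiv using arrows_eq_exch[OF ice] exch_antisym[of Q i j] by auto
  have indep: "arrows (S t) u v = 0" if "u \<in> set ?w" "v \<in> set ?w" for u v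
    using that arrows_colour(3) by (fastforce simp: arr setw)
  \<comment> \<open>No arrow comes from a frozen vertex, so new paths run only from \<open>v\<close>
    through \<open>u\<close> to a frozen vertex, which leaves \<open>\<Gamma>\<close> as the only
    factor.\<close>
  have out: "arrows (S t) (Inl u) (Inr w) = nat (half_step_vec ?V \<Gamma> (Suc t) u w)"
      "arrows (S t) (Inr w) (Inl u) = 0"
    if "u \<in> colour t" "w \<in> ?V" for u w
  proof -
    have "u \<in> ?V" using that colour_verts by auto
    then show "arrows (S t) (Inl u) (Inr w) = nat (half_step_vec ?V \<Gamma> (Suc t) u w)"
      "arrows (S t) (Inr w) (Inl u) = 0"
      unfolding arrows_eq_exch[OF S(1)] using cvec that nonneg exch_antisym[of "S t" "Inr w" "Inl u"] by auto
  qed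
  have next_S: "S (Suc t) = mutate_word ?w (S t)"
    by (simp add: S_def)
  have step: "is_ice_quiver (S (Suc t))" "verts (S (Suc t)) = ?V <+> ?V" "frozen (S (Suc t)) = Inr ` ?V"
    "\<And>j k. exch (S (Suc t)) j k = (if j \<in> Inl ` colour t \<or> k \<in> Inl ` colour t then - exch (S t) j k
       else exch (S t) j k + (if j \<in> Inr ` ?V \<and> k \<in> Inr ` ?V then 0
         else \<Sum>u\<in>colour t. through_paths (S t) (Inl u) j k))"
    using mutate_word_independent[OF S(1) dist mut indep] S
    unfolding next_S setw by (auto simp: sum.reindex)
  have "exch (S (Suc t)) (Inl i) (Inl j) = (if even (Suc t) then exch Q i j else - exch Q i j)" for i j
  proof (cases "i \<in> colour t \<or> j \<in> colour t")
    case True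
    then show ?thesis using quiv by (auto simp: step(4))
  next
    case False
    have "(\<Sum>u\<in>colour t. through_paths (S t) (Inl u) (Inl i) (Inl j)) =
        (\<Sum>u\<in>colour t. (if even t then 1 else -1) * through_paths Q u i j)"
      by (intro sum.cong) (auto simp: through_paths_def arr)
    also have "\<dots> = 0"
      using through_paths_cancel[of i t j] False by (simp flip: sum_distrib_left)
    finally show ?thesis
      using False quiv exch_zero[of i t j] by (auto simp: step(4))
  qed
  moreover have "exch (S (Suc t)) (Inl v) (Inr w) =
      (if v \<in> colour (Suc t) then half_step_vec ?V \<Gamma> (Suc (Suc t)) v w else - half_step_vec ?V \<Gamma> (Suc t) v w)"
    if v: "v \<in> ?V" and w: "w \<in> ?V" for v w
  proof (cases "v \<in> colour t")
    case True
    then show ?thesis using colour_Suc[OF v, of t] cvec[OF v w] by (auto simp: step(4))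
  next
    case False
    have "(\<Sum>u\<in>colour t. through_paths (S t) (Inl u) (Inl v) (Inr w)) =
        (\<Sum>u\<in>colour t. int (\<Gamma> v u) * half_step_vec ?V \<Gamma> (Suc t) u w)"
    proof (intro sum.cong refl)
      fix u assume u: "u \<in> colour t"
      then have "u \<in> ?V" using colour_verts by auto
      then show "through_paths (S t) (Inl u) (Inl v) (Inr w) = int (\<Gamma> v u) * half_step_vec ?V \<Gamma> (Suc t) u w"
        using out[OF u w] arr[of v u] Gamma_colour[OF False u] nonneg[OF _ w]
        by (simp add: through_paths_def)
    qed
    also have "\<dots> = (\<Sum>u\<in>?V. int (\<Gamma> v u) * half_step_vec ?V \<Gamma> (Suc t) u w)"
      using fin colour_verts Gamma_Delta_same_colour(1)[of v t] False
      by (intro sum.mono_neutral_left) auto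
    finally show ?thesis
      using False cvec[OF v w] colour_Suc[OF v, of t] by (auto simp: step(4) half_step_vec_rec)
  qed
  moreover have "green_word (S t) ?w"
  proof (rule green_word_independent[OF S(1) dist mut indep])
    fix u f assume "u \<in> set ?w" "f \<in> frozen (S t)"
    then obtain v w where "u = Inl v" "v \<in> colour t" "f = Inr w" "w \<in> ?V"
      by (auto simp: S setw)
    moreover have "v \<in> ?V" using calculation colour_verts by auto
    ultimately show "0 \<le> exch (S t) u f" using cvec nonneg by simp
  qed
  ultimately show ?case
    using step(1-3) green by (simp add: green_word_append S_def)
qed

text \<open>Greenness needs nonnegative entries up to index \<open>h\<close>; redness at the end
  needs the sign change at index \<open>h + 1\<close>.\<close>

lemma maximal_green_half_steps:
  assumes "connected_quiver Q" and ADE: "all_components_ADE (verts Q) \<Gamma>"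
    and C: "C \<in> components (verts Q) \<Gamma>" "has_dynkin_type \<Gamma> C X"
  shows "maximal_green_sequence Q (half_steps ws bs (coxeter_number X))"
proof -
  let ?h = "coxeter_number X" and ?V = "verts Q"
  have conn: "reachability ?V (\<lambda>i j. \<Gamma> i j + \<Delta> i j) = ?V \<times> ?V"
    using assms(1) by (simp add: connected_quiver_def Gamma_plus_Delta)
  have h: "2 \<le> ?h" using C(2) by (auto simp: has_dynkin_type_def coxeter_number_ge_2)
  have cheb: "0 \<le> cheb ?V \<Gamma> t v w \<and> (t = ?h \<longrightarrow> cheb ?V \<Gamma> t v w = 0)"
    if "v \<in> ?V" "t \<le> ?h" for t v w
  proof -
    obtain D where D: "D \<in> components ?V \<Gamma>" "v \<in> D"
      using in_component[OF \<open>v \<in> ?V\<close>] by blast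
    then obtain Y where Y: "has_dynkin_type \<Gamma> D Y" using ADE by (auto simp: all_components_ADE_def)
    have "?h = coxeter_number Y"
      by (rule coxeter_numbers_equal[OF fin Gamma_Delta_commute conn ADE C D(1) Y])
    then show ?thesis using cheb_ADE_component[OF fin D(1) Y D(2), of t w] that by simp
  qed
  have nonneg: "0 \<le> half_step_vec ?V \<Gamma> (Suc s) v w" if "s < ?h" "v \<in> ?V" for s v w
    using cheb[of v s w] cheb[of v "Suc s" w] that by (simp add: half_step_vec_def)
  have final: "half_step_vec ?V \<Gamma> (Suc ?h) v w \<le> 0" if "v \<in> ?V" for v w
  proof -
    obtain s where s: "?h = Suc s" using h by (cases ?h) auto
    \<comment> \<open>The matrix at index \<open>Suc s\<close>, the Coxeter number, vanishes, so its
      neighbours in the recurrence are opposite.\<close>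
    have "cheb ?V \<Gamma> (Suc (Suc s)) v w = - cheb ?V \<Gamma> s v w"
      using cheb[of _ ?h] s by simp
    then show ?thesis using cheb[of v s w] cheb[of v ?h w] that s by (simp add: half_step_vec_def)
  qed
  define S where "S = mutate_word (map Inl (half_steps ws bs ?h)) (framed Q)"
  have S: "is_ice_quiver S" "verts S = ?V <+> ?V" "frozen S = Inr ` ?V"
    and cvec: "\<And>v w. v \<in> ?V \<Longrightarrow> w \<in> ?V \<Longrightarrow> exch S (Inl v) (Inr w) =
      (if v \<in> colour ?h then half_step_vec ?V \<Gamma> (Suc ?h) v w else - half_step_vec ?V \<Gamma> ?h v w)"
    and green: "green_word (framed Q) (map Inl (half_steps ws bs ?h))"
    using half_step_state[of ?h] nonneg unfolding S_def by auto
  \<comment> \<open>This handles the colour mutated last, whose entries are the negatives of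
    these.\<close>
  have "0 \<le> half_step_vec ?V \<Gamma> ?h v w" if "v \<in> ?V" for v w
    using nonneg[of "?h - 1" v w] that h by simp
  then have "exch S (Inl v) (Inr w) \<le> 0" if "v \<in> ?V" "w \<in> ?V" for v w
    using cvec final that by simp
  then have "red S x" if "x \<in> mutable S" for x
    using that S by (auto simp: red_def mutable_def arrows_eq_exch[OF S(1)])
  then show ?thesis
    unfolding S_def by (rule maximal_green_sequence_green_word[OF green])
qed

end

theorem theorem5p3:
  fixes Q :: "'v ice_quiver" and \<epsilon> :: "'v \<Rightarrow> nat"
    and ws bs :: "'v list" and C :: "'v set" and X :: dynkin and h k :: nat
  assumes "is_quiver Q"
    and "connected_quiver Q"
    and "bipartition Q \<epsilon>"
    and "enumerates ws (white Q \<epsilon>)"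
    and "enumerates bs (black Q \<epsilon>)"
    and "recurrent Q ws bs"
    and "half_finite Q \<epsilon>"
    and "all_components_ADE (verts Q) (Gamma Q \<epsilon>)"
    and "\<forall>v\<in>white Q \<epsilon>. is_sink (verts Q) (Gamma_dir Q \<epsilon>) v \<and> is_source (verts Q) (Delta_dir Q \<epsilon>) v"
    and "C \<in> components (verts Q) (Gamma Q \<epsilon>)"
    and "has_dynkin_type (Gamma Q \<epsilon>) C X"
    and "h = coxeter_number X"
  shows "(h = 2 * k \<longrightarrow> maximal_green_sequence Q (word_power (bs @ ws) k)) \<and>
         (h = 2 * k + 1 \<longrightarrow> maximal_green_sequence Q (ws @ word_power (bs @ ws) k))"
proof -
  interpret recurrent_quiver Q \<epsilon> ws bs
    using assms by unfold_locales
  have "maximal_green_sequence Q (half_steps ws bs h)"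
    using maximal_green_half_steps assms by simp
  \<comment> \<open>The last half-step has the even index \<open>2 * k\<close>, hence is
    white.\<close>
  moreover have "half_steps ws bs (2 * k + 1) = ws @ word_power (bs @ ws) k"
    using half_steps_even[of ws bs k] by (simp add: turn_def)
  ultimately show ?thesis using half_steps_even[of ws bs k] by auto
qed

end
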